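(* Let $\mathbb{F}$ be a normed field with $\mathrm{char}(\mathbb{F})=0$, let $\mathfrak{A}$ be a metric $\mathbb{F}$-algebra, and let $C(\mathfrak{A})$ be its completion. If $C(\mathfrak{A})$ is nil, then $\mathfrak{A}$ is nilpotent.
   Context: Algebras are associative and not necessarily unital. An algebra $\mathfrak{A}$ is nil if for every $a\in\mathfrak{A}$ there is a positive integer $n$ (depending on $a$) with $a^n=0$; it is nilpotent if there is a positive integer $n$ with $\mathfrak{A}^n=\{0\}$, i.e. $a_1a_2\cdots a_n=0$ for all $a_1,\dots,a_n\in\mathfrak{A}$. A normed field is a field $\mathbb{F}$ equipped with a map $|\cdot|:\mathbb{F}\to\mathbb{R}_{\geq 0}$ having the usual properties of a norm ($|\lambda|=0$ iff $\lambda=0$, and $|\lambda+\mu|\leq|\lambda|+|\mu|$) and satisfying $|-\lambda|=|\lambda|$ and $|\lambda\mu|\leq|\lambda|\cdot|\mu|$ for all $\lambda,\mu\in\mathbb{F}$. When $\mathrm{char}(\mathbb{F})=0$, it is moreover assumed, as part of the definition, that $|n\cdot\lambda|=n\cdot|\lambda|$ for all $n\in\mathbb{N}$ and $\lambda\in\mathbb{F}$. Let $\mathbb{F}$ be a normed field. A metric $\mathbb{F}$-algebra is an associative $\mathbb{F}$-algebra $\mathfrak{A}$ which is also a metric space $(\mathfrak{A},\mathsf{d})$, such that there is a real number $\gamma>0$ with: (i) $\mathsf{d}(a+c,b+c)\leq\gamma\,\mathsf{d}(a,b)$ for all $a,b,c\in\mathfrak{A}$; (ii) $\mathsf{d}(\lambda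 a,\lambda b)\leq\gamma|\lambda|\,\mathsf{d}(a,b)$ for all $\lambda\in\mathbb{F}$, $a,b\in\mathfrak{A}$; (iii) $\mathsf{d}(ac,bc)\leq\gamma\,\mathsf{d}(c,0)\,\mathsf{d}(a,b)$ and $\mathsf{d}(ca,cb)\leq\gamma\,\mathsf{d}(c,0)\,\mathsf{d}(a,b)$ for all $a,b,c\in\mathfrak{A}$. The completion $C(\mathfrak{A})$ is the metric completion of $(\mathfrak{A},\mathsf{d})$, i.e. a complete metric space containing $\mathfrak{A}$ isometrically as a dense subset, with addition, multiplication and multiplication by scalars of $\mathbb{F}$ extended from $\mathfrak{A}$ by continuity; with these operations $C(\mathfrak{A})$ is a complete metric $\mathbb{F}$-algebra (a metric $\mathbb{F}$-algebra whose metric is complete) containing $\mathfrak{A}$ as a subalgebra. *)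

theory Defs
  imports "HOL-Analysis.Analysis"
begin

text \<open>
  The normed fields considered here are only submultiplicative, so they are not instances of
  the library's normed classes. The condition of the last axiom is part of the
  notion only in characteristic zero.
\<close>

locale normed_field =
  fixes nrm :: "'f::field \<Rightarrow> real"
  assumes nrm_nonneg: "0 \<le> nrm \<alpha>"
    and nrm_eq_0_iff: "nrm \<alpha> = 0 \<longleftrightarrow> \<alpha> = 0"
    and nrm_add_le: "nrm (\<alpha> + \<beta>) \<le> nrm \<alpha> + nrm \<beta>"
    and nrm_minus: "nrm (- \<alpha>) = nrm \<alpha>"
    and nrm_mult_le: "nrm (\<alpha> * \<beta>) \<le> nrm \<alpha> * nrm \<beta>"
    and nrm_of_nat_mult: "CHAR('f) = 0 \<Longrightarrow> nrm (of_nat n * \<alpha>) = real n * nrm \<alpha>"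

text \<open>
  The class \<open>ring\<close> is that of associative, not necessarily unital or commutative rings.
\<close>

locale assoc_algebra = vector_space scale
  for scale :: "'f::field \<Rightarrow> 'a::ring \<Rightarrow> 'a" +
  assumes scale_mult_left: "scale \<alpha> a * b = scale \<alpha> (a * b)"
    and scale_mult_right: "a * scale \<alpha> b = scale \<alpha> (a * b)"

locale metric_algebra = normed_field nrm + assoc_algebra scale
  for nrm :: "'f::field \<Rightarrow> real"
    and scale :: "'f \<Rightarrow> 'a::{ring, metric_space} \<Rightarrow> 'a" +
  assumes ex_gamma: "\<exists>\<gamma>>0.
      (\<forall>a b c :: 'a. dist (a + c) (b + c) \<le> \<gamma> * dist a b) \<and>
      (\<forall>\<alpha> a b. dist (scale \<alpha> a) (scale \<alpha> b) \<le> \<gamma> * nrm \<alpha> * dist a b) \<and>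
      (\<forall>a b c :: 'a. dist (a * c) (b * c) \<le> \<gamma> * dist c 0 * dist a b) \<and>
      (\<forall>a b c :: 'a. dist (c * a) (c * b) \<le> \<gamma> * dist c 0 * dist a b)"

text \<open>
  \<open>\<iota>\<close> exhibits the complete metric space \<open>'c\<close> as the completion of \<open>'a\<close>: it is an isometric
  embedding with dense image, and the operations of \<open>'c\<close> are the continuous extensions of those
  of \<open>'a\<close>. This determines \<open>'c\<close> with its operations up to a unique isometric isomorphism
  over \<open>'a\<close>. That \<open>'c\<close> is again a metric algebra need not be required, see below.
\<close>

locale algebra_completion =
  fixes scale :: "'f::field \<Rightarrow> 'a::{ring, metric_space} \<Rightarrow> 'a"
    and scaleC :: "'f \<Rightarrow> 'c::{ring, complete_space} \<Rightarrow> 'c"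
    and \<iota> :: "'a \<Rightarrow> 'c"
  assumes isometric: "dist (\<iota> a) (\<iota> b) = dist a b"
    and dense: "closure (range \<iota>) = UNIV"
    and extends_add: "\<iota> (a + b) = \<iota> a + \<iota> b"
    and extends_mult: "\<iota> (a * b) = \<iota> a * \<iota> b"
    and extends_scale: "\<iota> (scale \<alpha> a) = scaleC \<alpha> (\<iota> a)"
    and continuous_add: "continuous_on UNIV (\<lambda>(x :: 'c, y). x + y)"
    and continuous_mult: "continuous_on UNIV (\<lambda>(x :: 'c, y). x * y)"
    and continuous_scale: "continuous_on UNIV (scaleC \<alpha>)"

text \<open>
  Without a unit, products and powers are formed of at least one factor only; the value at the
  empty list is a dummy.
\<close>

fun nonempty_prod :: "'a::ring list \<Rightarrow> 'a" where
  "nonempty_prod [] = 0"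
| "nonempty_prod [a] = a"
| "nonempty_prod (a # b # as) = a * nonempty_prod (b # as)"

definition nil_algebra :: "'a::ring itself \<Rightarrow> bool" where
  "nil_algebra _ \<longleftrightarrow> (\<forall>a::'a. \<exists>n>0. nonempty_prod (replicate n a) = 0)"

definition nilpotent_algebra :: "'a::ring itself \<Rightarrow> bool" where
  "nilpotent_algebra _ \<longleftrightarrow>
     (\<exists>n>0. \<forall>as::'a list. length as = n \<longrightarrow> nonempty_prod as = 0)"

context algebra_completion
begin

lemma approx: obtains s where "(\<lambda>n. \<iota> (s n)) \<longlonglongrightarrow> x"
proof -
  have "x \<in> closure (range \<iota>)" by (simp add: dense)
  then obtain t where t: "\<And>n. t n \<in> range \<iota>" "t \<longlonglongrightarrow> x"
    unfolding closure_sequential by auto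
  from t(1) have "\<exists>s. \<forall>n. t n = \<iota> (s n)" by (intro choice) auto
  then obtain s where "t = (\<lambda>n. \<iota> (s n))" by auto
  with t(2) show ?thesis using that by auto
qed

lemma tendsto_addC:
  assumes "s \<longlonglongrightarrow> x" "t \<longlonglongrightarrow> y" shows "(\<lambda>n. s n + t n) \<longlonglongrightarrow> x + (y :: 'c)"
  using continuous_on_tendsto_compose[OF continuous_add tendsto_Pair[OF assms]] by simp

lemma tendsto_multC:
  assumes "s \<longlonglongrightarrow> x" "t \<longlonglongrightarrow> y" shows "(\<lambda>n. s n * t n) \<longlonglongrightarrow> x * (y :: 'c)"
  using continuous_on_tendsto_compose[OF continuous_mult tendsto_Pair[OF assms]] by simp

lemma tendsto_scaleC:
  assumes "s \<longlonglongrightarrow> x" shows "(\<lambda>n. scaleC \<alpha> (s n)) \<longlonglongrightarrow> scaleC \<alpha> x"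
  using continuous_on_tendsto_compose[OF continuous_scale assms] by simp

lemmas tendsto_opsC = tendsto_addC tendsto_multC tendsto_scaleC

lemma iota_0: "\<iota> 0 = 0"
  using extends_add[of 0 0] by simp

lemma dist_iota_0: "dist (\<iota> a) 0 = dist a 0"
  using isometric[of a 0] by (simp add: iota_0)

lemma assoc_algebra_completion:
  assumes "assoc_algebra scale"
  shows "assoc_algebra scaleC"
proof -
  interpret A: assoc_algebra scale by fact
  note ext = extends_add[symmetric] extends_mult[symmetric] extends_scale[symmetric]
  show ?thesis
  proof
    fix \<alpha> \<beta> :: 'f and x y :: 'c
    obtain s where s: "(\<lambda>n. \<iota> (s n)) \<longlonglongrightarrow> x" by (rule approx)
    obtain t where t: "(\<lambda>n. \<iota> (t n)) \<longlonglongrightarrow> y" by (rule approx)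
    show "scaleC \<alpha> (x + y) = scaleC \<alpha> x + scaleC \<alpha> y"
    proof (rule LIMSEQ_unique)
      show "(\<lambda>n. scaleC \<alpha> (\<iota> (s n) + \<iota> (t n))) \<longlonglongrightarrow> scaleC \<alpha> (x + y)"
        by (intro tendsto_opsC s t)
      have "(\<lambda>n. scaleC \<alpha> (\<iota> (s n)) + scaleC \<alpha> (\<iota> (t n))) \<longlonglongrightarrow> scaleC \<alpha> x + scaleC \<alpha> y"
        by (intro tendsto_opsC s t)
      then show "(\<lambda>n. scaleC \<alpha> (\<iota> (s n) + \<iota> (t n))) \<longlonglongrightarrow> scaleC \<alpha> x + scaleC \<alpha> y"
        by (simp add: ext A.scale_right_distrib)
    qed
    show "scaleC (\<alpha> + \<beta>) x = scaleC \<alpha> x + scaleC \<beta> x"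
    proof (rule LIMSEQ_unique)
      show "(\<lambda>n. scaleC (\<alpha> + \<beta>) (\<iota> (s n))) \<longlonglongrightarrow> scaleC (\<alpha> + \<beta>) x"
        by (intro tendsto_opsC s t)
      have "(\<lambda>n. scaleC \<alpha> (\<iota> (s n)) + scaleC \<beta> (\<iota> (s n))) \<longlonglongrightarrow> scaleC \<alpha> x + scaleC \<beta> x"
        by (intro tendsto_opsC s t)
      then show "(\<lambda>n. scaleC (\<alpha> + \<beta>) (\<iota> (s n))) \<longlonglongrightarrow> scaleC \<alpha> x + scaleC \<beta> x"
        by (simp add: ext A.scale_left_distrib)
    qed
    show "scaleC \<alpha> (scaleC \<beta> x) = scaleC (\<alpha> * \<beta>) x"
    proof (rule LIMSEQ_unique)
      show "(\<lambda>n. scaleC \<alpha> (scaleC \<beta> (\<iota> (s n)))) \<longlonglongrightarrow> scaleC \<alpha> (scaleC \<beta> x)"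
        by (intro tendsto_opsC s t)
      have "(\<lambda>n. scaleC (\<alpha> * \<beta>) (\<iota> (s n))) \<longlonglongrightarrow> scaleC (\<alpha> * \<beta>) x"
        by (intro tendsto_opsC s t)
      then show "(\<lambda>n. scaleC \<alpha> (scaleC \<beta> (\<iota> (s n)))) \<longlonglongrightarrow> scaleC (\<alpha> * \<beta>) x"
        by (simp add: ext)
    qed
    show "scaleC 1 x = x"
    proof (rule LIMSEQ_unique)
      show "(\<lambda>n. scaleC 1 (\<iota> (s n))) \<longlonglongrightarrow> scaleC 1 x" by (intro tendsto_opsC s)
      show "(\<lambda>n. scaleC 1 (\<iota> (s n))) \<longlonglongrightarrow> x" using s by (simp add: ext)
    qed
    show "scaleC \<alpha> x * y = scaleC \<alpha> (x * y)"
    proof (rule LIMSEQ_unique)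
      show "(\<lambda>n. scaleC \<alpha> (\<iota> (s n)) * \<iota> (t n)) \<longlonglongrightarrow> scaleC \<alpha> x * y"
        by (intro tendsto_opsC s t)
      have "(\<lambda>n. scaleC \<alpha> (\<iota> (s n) * \<iota> (t n))) \<longlonglongrightarrow> scaleC \<alpha> (x * y)"
        by (intro tendsto_opsC s t)
      then show "(\<lambda>n. scaleC \<alpha> (\<iota> (s n)) * \<iota> (t n)) \<longlonglongrightarrow> scaleC \<alpha> (x * y)"
        by (simp add: ext A.scale_mult_left)
    qed
    show "x * scaleC \<alpha> y = scaleC \<alpha> (x * y)"
    proof (rule LIMSEQ_unique)
      show "(\<lambda>n. \<iota> (s n) * scaleC \<alpha> (\<iota> (t n))) \<longlonglongrightarrow> x * scaleC \<alpha> y"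
        by (intro tendsto_opsC s t)
      have "(\<lambda>n. scaleC \<alpha> (\<iota> (s n) * \<iota> (t n))) \<longlonglongrightarrow> scaleC \<alpha> (x * y)"
        by (intro tendsto_opsC s t)
      then show "(\<lambda>n. \<iota> (s n) * scaleC \<alpha> (\<iota> (t n))) \<longlonglongrightarrow> scaleC \<alpha> (x * y)"
        by (simp add: ext A.scale_mult_right)
    qed
  qed
qed

lemma metric_algebra_completion:
  assumes "metric_algebra nrm scale"
  shows "metric_algebra nrm scaleC"
proof -
  interpret A: metric_algebra nrm scale by fact
  interpret C: assoc_algebra scaleC
    by (rule assoc_algebra_completion) (rule A.assoc_algebra_axioms)
  note ext = extends_add[symmetric] extends_mult[symmetric] extends_scale[symmetric]
    isometric dist_iota_0
  from A.ex_gamma obtain \<gamma> where \<gamma>: "\<gamma> > 0"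
    "\<And>a b c. dist (a + c) (b + c :: 'a) \<le> \<gamma> * dist a b"
    "\<And>\<alpha> a b. dist (scale \<alpha> a) (scale \<alpha> b) \<le> \<gamma> * nrm \<alpha> * dist a b"
    "\<And>a b c. dist (a * c) (b * c :: 'a) \<le> \<gamma> * dist c 0 * dist a b"
    "\<And>a b c. dist (c * a) (c * b :: 'a) \<le> \<gamma> * dist c 0 * dist a b" by blast
  show ?thesis
  proof (unfold_locales, intro exI[of _ \<gamma>] conjI allI \<gamma>(1))
    fix \<alpha> :: 'f and x y z :: 'c
    obtain s where s: "(\<lambda>n. \<iota> (s n)) \<longlonglongrightarrow> x" by (rule approx)
    obtain t where t: "(\<lambda>n. \<iota> (t n)) \<longlonglongrightarrow> y" by (rule approx)
    obtain u where u: "(\<lambda>n. \<iota> (u n)) \<longlonglongrightarrow> z" by (rule approx)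
    note lim = tendsto_dist tendsto_mult_left tendsto_const tendsto_opsC s t u
    note lim' = tendsto_mult[where 'a = real] lim
    show "dist (x + z) (y + z) \<le> \<gamma> * dist x y"
      by (rule LIMSEQ_le[where X = "\<lambda>n. dist (\<iota> (s n) + \<iota> (u n)) (\<iota> (t n) + \<iota> (u n))"
            and Y = "\<lambda>n. \<gamma> * dist (\<iota> (s n)) (\<iota> (t n))"])
        (intro lim', intro lim', simp add: ext \<gamma>)
    show "dist (scaleC \<alpha> x) (scaleC \<alpha> y) \<le> \<gamma> * nrm \<alpha> * dist x y"
      by (rule LIMSEQ_le[where X = "\<lambda>n. dist (scaleC \<alpha> (\<iota> (s n))) (scaleC \<alpha> (\<iota> (t n)))"
            and Y = "\<lambda>n. \<gamma> * nrm \<alpha> * dist (\<iota> (s n)) (\<iota> (t n))"])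
        (intro lim', intro lim', simp add: ext \<gamma>)
    show "dist (x * z) (y * z) \<le> \<gamma> * dist z 0 * dist x y"
      by (rule LIMSEQ_le[where X = "\<lambda>n. dist (\<iota> (s n) * \<iota> (u n)) (\<iota> (t n) * \<iota> (u n))"
            and Y = "\<lambda>n. \<gamma> * dist (\<iota> (u n)) 0 * dist (\<iota> (s n)) (\<iota> (t n))"])
        (intro lim', intro lim', simp add: ext \<gamma>)
    show "dist (z * x) (z * y) \<le> \<gamma> * dist z 0 * dist x y"
      by (rule LIMSEQ_le[where X = "\<lambda>n. dist (\<iota> (u n) * \<iota> (s n)) (\<iota> (u n) * \<iota> (t n))"
            and Y = "\<lambda>n. \<gamma> * dist (\<iota> (u n)) 0 * dist (\<iota> (s n)) (\<iota> (t n))"])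
        (intro lim', intro lim', simp add: ext \<gamma>)
  qed
qed

end

end

theory Submission
  imports Defs
begin

text \<open>
  The sets \<open>{x. x\<^sup>n = 0}\<close> are closed and cover the completion, so by Baire one of them contains a
  nonempty open set \<open>U\<close>. For \<open>c \<in> U\<close> and arbitrary \<open>a\<close>, the element \<open>c + \<alpha> a\<close> lies in \<open>U\<close> for all
  \<open>\<alpha> = 1/k\<close> with \<open>k\<close> large, because \<open>|1/k| = |1|/k\<close>. Hence the polynomial \<open>(c + \<alpha> a)\<^sup>n\<close> in \<open>\<alpha>\<close> has
  infinitely many roots, and its leading coefficient \<open>a\<^sup>n\<close> vanishes. The completion is thus nil of
  bounded index, and nilpotent by the Nagata--Higman theorem.
\<close>

section \<open>Products over nonempty lists\<close>

lemma nonempty_prod_Cons: "as \<noteq> [] \<Longrightarrow> nonempty_prod (a # as) = a * nonempty_prod as"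
  by (cases as) auto

lemma nonempty_prod_append:
  "as \<noteq> [] \<Longrightarrow> bs \<noteq> [] \<Longrightarrow> nonempty_prod (as @ bs) = nonempty_prod as * nonempty_prod bs"
  by (induction as rule: nonempty_prod.induct) (auto simp: nonempty_prod_Cons mult.assoc)

text \<open>Used to treat a subword as a single letter. \<open>bs\<close> must be nonempty, since
  the product of the empty list is the dummy 0 and not a neutral factor.\<close>

lemma nonempty_prod_nested:
  assumes "bs \<noteq> []"
  shows "nonempty_prod (as @ nonempty_prod bs # cs) = nonempty_prod (as @ bs @ cs)"
proof -
  have "nonempty_prod (nonempty_prod bs # cs) = nonempty_prod (bs @ cs)"
    using assms by (cases cs) (auto simp: nonempty_prod_append)
  then show ?thesis
    using assms by (cases as) (simp_all add: nonempty_prod_append flip: append_Cons)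
qed

section \<open>Polynomials with coefficients in a vector space\<close>

text \<open>The factor theorem for vector coefficients: the cofactor of \<alpha> - \<mu> has degree
  one less and the same leading coefficient, so degree induction can follow that
  coefficient.\<close>

lemma (in vector_space) poly_difference:
  "\<exists>d. (\<forall>\<alpha>. (\<Sum>k\<le>Suc n. scale (\<alpha> ^ k) (c k)) - (\<Sum>k\<le>Suc n. scale (\<mu> ^ k) (c k)) =
           scale (\<alpha> - \<mu>) (\<Sum>k\<le>n. scale (\<alpha> ^ k) (d k))) \<and> d n = c (Suc n)"
proof (induction n)
  case 0
  show ?case by (rule exI[of _ "\<lambda>_. c 1"]) (simp add: scale_left_diff_distrib)
next
  case (Suc n)
  then obtain d where d: "\<And>\<alpha>. (\<Sum>k\<le>Suc n. scale (\<alpha> ^ k) (c k)) - (\<Sum>k\<le>Suc n. scale (\<mu> ^ k) (c k)) =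
           scale (\<alpha> - \<mu>) (\<Sum>k\<le>n. scale (\<alpha> ^ k) (d k))" by blast
  let ?c = "c (Suc (Suc n))"
  \<comment> \<open>The old cofactor, cut off at \<open>n\<close> because its values beyond are
    arbitrary, plus the terms of the geometric sum dividing \<alpha>^(n+2) - \<mu>^(n+2) by \<alpha>
    - \<mu>.\<close>
  let ?d = "\<lambda>k. (if k \<le> n then d k else 0) + scale (\<mu> ^ (Suc n - k)) ?c"
  have "(\<Sum>k\<le>Suc (Suc n). scale (\<alpha> ^ k) (c k)) - (\<Sum>k\<le>Suc (Suc n). scale (\<mu> ^ k) (c k)) =
      scale (\<alpha> - \<mu>) (\<Sum>k\<le>Suc n. scale (\<alpha> ^ k) (?d k))" for \<alpha>
  proof -
    have "\<alpha> ^ Suc (Suc n) - \<mu> ^ Suc (Suc n) = (\<alpha> - \<mu>) * (\<Sum>k\<le>Suc n. \<alpha> ^ k * \<mu> ^ (Suc n - k))"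
      by (subst diff_power_eq_sum) (simp add: lessThan_Suc_atMost)
    then have "scale (\<alpha> ^ Suc (Suc n)) ?c - scale (\<mu> ^ Suc (Suc n)) ?c =
        scale (\<alpha> - \<mu>) (\<Sum>k\<le>Suc n. scale (\<alpha> ^ k) (scale (\<mu> ^ (Suc n - k)) ?c))"
      by (simp only: scale_left_diff_distrib[symmetric] scale_scale scale_sum_left[symmetric])
    moreover have "(\<Sum>k\<le>Suc n. scale (\<alpha> ^ k) (?d k)) =
        (\<Sum>k\<le>n. scale (\<alpha> ^ k) (d k)) + (\<Sum>k\<le>Suc n. scale (\<alpha> ^ k) (scale (\<mu> ^ (Suc n - k)) ?c))"
      by (simp only: scale_right_distrib sum.distrib) simp
    ultimately show ?thesis
      using d[of \<alpha>] by (simp only: scale_right_distrib sum.atMost_Suc[of _ "Suc n"]) (simp add: algebra_simps)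
  qed
  then show ?case by (intro exI[of _ ?d]) simp
qed

text \<open>Subtracting the value at some \<mu> in \<open>S\<close> and dividing by \<alpha> - \<mu>
  lowers the degree and costs \<open>S\<close> only one point.\<close>

lemma (in vector_space) lead_coeff_in_subspace:
  assumes "subspace I" "infinite S" "\<And>\<alpha>. \<alpha> \<in> S \<Longrightarrow> (\<Sum>k\<le>n. scale (\<alpha> ^ k) (c k)) \<in> I"
  shows "c n \<in> I"
  using assms(2,3)
proof (induction n arbitrary: c S)
  case 0
  then obtain \<alpha> where "\<alpha> \<in> S" using infinite_imp_nonempty by blast
  with 0 show ?case by force
next
  case (Suc n)
  then obtain \<mu> where \<mu>: "\<mu> \<in> S" using infinite_imp_nonempty by blast
  obtain d where d: "\<And>\<alpha>. (\<Sum>k\<le>Suc n. scale (\<alpha> ^ k) (c k)) - (\<Sum>k\<le>Suc n. scale (\<mu> ^ k) (c k)) =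
      scale (\<alpha> - \<mu>) (\<Sum>k\<le>n. scale (\<alpha> ^ k) (d k))" "d n = c (Suc n)"
    using poly_difference by blast
  have "d n \<in> I"
  proof (rule Suc.IH)
    show "infinite (S - {\<mu>})" using Suc.prems(1) by simp
    fix \<alpha> assume \<alpha>: "\<alpha> \<in> S - {\<mu>}"
    then have "scale (\<alpha> - \<mu>) (\<Sum>k\<le>n. scale (\<alpha> ^ k) (d k)) \<in> I"
      using Suc.prems(2) \<mu> by (subst d(1)[symmetric]) (intro subspace_diff assms(1), auto)
    then have "scale (inverse (\<alpha> - \<mu>)) (scale (\<alpha> - \<mu>) (\<Sum>k\<le>n. scale (\<alpha> ^ k) (d k))) \<in> I"
      by (rule subspace_scale[OF assms(1)])
    then show "(\<Sum>k\<le>n. scale (\<alpha> ^ k) (d k)) \<in> I" using \<alpha> by simp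
  qed
  with d(2) show ?case by simp
qed

text \<open>Once the leading coefficient lies in \<open>I\<close>, its term can be subtracted
  without leaving \<open>I\<close>, and the degree drops.\<close>

lemma (in vector_space) coeffs_in_subspace:
  assumes "subspace I" "infinite S" "\<And>\<alpha>. \<alpha> \<in> S \<Longrightarrow> (\<Sum>k\<le>n. scale (\<alpha> ^ k) (c k)) \<in> I"
    and "k \<le> n"
  shows "c k \<in> I"
  using assms(3,4)
proof (induction n)
  case 0
  then show ?case using lead_coeff_in_subspace[OF assms(1,2), where n = 0 and c = c] by simp
next
  case (Suc n)
  have top: "c (Suc n) \<in> I"
    by (rule lead_coeff_in_subspace[OF assms(1,2)]) (use Suc.prems in auto)
  have "(\<Sum>k\<le>n. scale (\<alpha> ^ k) (c k)) \<in> I" if "\<alpha> \<in> S" for \<alpha>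
    using subspace_diff[OF assms(1) Suc.prems(1)[OF that] subspace_scale[OF assms(1) top, of "\<alpha> ^ Suc n"]]
    by simp
  then show ?case using Suc.IH Suc.prems(2) top by (cases "k = Suc n") auto
qed

section \<open>Expansion of powers of a sum\<close>

text \<open>The sum is the part of \<open>(x + y) ^ Suc m\<close> that is linear in \<open>y\<close>.\<close>

definition power_deriv :: "'a::ring \<Rightarrow> 'a \<Rightarrow> nat \<Rightarrow> 'a" where
  "power_deriv x y m = (\<Sum>i\<le>m. nonempty_prod (replicate i x @ y # replicate (m - i) x))"

lemma power_deriv_0: "power_deriv x y 0 = y"
  by (simp add: power_deriv_def)

lemma power_deriv_Suc:
  "power_deriv x y (Suc m) = x * power_deriv x y m + y * nonempty_prod (replicate (Suc m) x)"
  unfolding power_deriv_def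
  by (subst sum.atMost_Suc_shift) (simp add: nonempty_prod_Cons sum_distrib_left)

text \<open>Multiplying by x + \<alpha>y on the left turns the coefficients into
  \<open>x * c k + y * c (k - 1)\<close>. The constant one feeds the recursion of the linear one,
  and vanishing above the degree lets the sum be extended by a term.\<close>

lemma (in assoc_algebra) power_expansion:
  "\<exists>c. (\<forall>\<alpha>. nonempty_prod (replicate (Suc m) (x + scale \<alpha> y)) = (\<Sum>k\<le>Suc m. scale (\<alpha> ^ k) (c k))) \<and>
     c 0 = nonempty_prod (replicate (Suc m) x) \<and> c 1 = power_deriv x y m \<and>
     c (Suc m) = nonempty_prod (replicate (Suc m) y) \<and> (\<forall>k>Suc m. c k = 0)"
proof (induction m)
  case 0
  show ?case
    by (rule exI[of _ "\<lambda>k. if k = 0 then x else if k = 1 then y else 0"]) (simp add: power_deriv_0)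
next
  case (Suc m)
  then obtain c where c: "\<And>\<alpha>. nonempty_prod (replicate (Suc m) (x + scale \<alpha> y)) = (\<Sum>k\<le>Suc m. scale (\<alpha> ^ k) (c k))"
     "c 0 = nonempty_prod (replicate (Suc m) x)" "c 1 = power_deriv x y m"
     "c (Suc m) = nonempty_prod (replicate (Suc m) y)" "\<And>k. k > Suc m \<Longrightarrow> c k = 0" by blast
  let ?c = "\<lambda>k. x * c k + (case k of 0 \<Rightarrow> 0 | Suc k \<Rightarrow> y * c k)"
  have "nonempty_prod (replicate (Suc (Suc m)) (x + scale \<alpha> y)) = (\<Sum>k\<le>Suc (Suc m). scale (\<alpha> ^ k) (?c k))" for \<alpha>
  proof -
    have "(\<Sum>k\<le>Suc (Suc m). scale (\<alpha> ^ k) (?c k)) = (\<Sum>k\<le>Suc (Suc m). scale (\<alpha> ^ k) (x * c k)) +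
      (\<Sum>k\<le>Suc (Suc m). scale (\<alpha> ^ k) (case k of 0 \<Rightarrow> 0 | Suc k \<Rightarrow> y * c k))"
      by (simp only: scale_right_distrib sum.distrib)
    also have "(\<Sum>k\<le>Suc (Suc m). scale (\<alpha> ^ k) (x * c k)) = x * (\<Sum>k\<le>Suc m. scale (\<alpha> ^ k) (c k))"
      using c(5)[of "Suc (Suc m)"] by (simp add: sum_distrib_left scale_mult_right distrib_left)
    also have "(\<Sum>k\<le>Suc (Suc m). scale (\<alpha> ^ k) (case k of 0 \<Rightarrow> 0 | Suc k \<Rightarrow> y * c k)) =
        scale \<alpha> y * (\<Sum>k\<le>Suc m. scale (\<alpha> ^ k) (c k))"
      by (subst sum.atMost_Suc_shift)
        (simp add: sum_distrib_left scale_mult_right scale_mult_left scale_sum_right distrib_left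
          scale_right_distrib mult.commute del: sum.atMost_Suc)
    finally show ?thesis
      using c(1)[of \<alpha>] by (simp add: distrib_right)
  qed
  moreover have "?c 0 = nonempty_prod (replicate (Suc (Suc m)) x)" using c(2) by simp
  moreover have "?c 1 = power_deriv x y (Suc m)"
    using c(2,3) by (simp add: power_deriv_Suc)
  moreover have "?c (Suc (Suc m)) = nonempty_prod (replicate (Suc (Suc m)) y)"
    using c(4) c(5)[of "Suc (Suc m)"] by simp
  moreover have "\<forall>k>Suc (Suc m). ?c k = 0" using c(5) by (auto split: nat.split)
  ultimately show ?case by (intro exI[of _ ?c] conjI) auto
qed

lemma inj_of_nat_CHAR_0:
  assumes "CHAR('f::ring_1) = 0"
  shows "inj (of_nat :: nat \<Rightarrow> 'f)"
proof (rule linorder_injI)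
  fix m n :: nat assume "m < n"
  then have "(of_nat (n - m) :: 'f) \<noteq> 0" using assms by (simp only: of_nat_eq_0_iff_char_dvd) simp
  moreover have "(of_nat (n - m) :: 'f) = of_nat n - of_nat m" using \<open>m < n\<close> by simp
  ultimately show "(of_nat m :: 'f) \<noteq> of_nat n" by auto
qed

section \<open>Ideals and the Nagata-Higman theorem\<close>

context assoc_algebra
begin

definition alg_ideal :: "'a set \<Rightarrow> bool" where
  "alg_ideal I \<longleftrightarrow> subspace I \<and> (\<forall>a\<in>I. \<forall>b. a * b \<in> I \<and> b * a \<in> I)"

lemma alg_ideal_mult_right: "alg_ideal I \<Longrightarrow> a \<in> I \<Longrightarrow> a * b \<in> I"
  and alg_ideal_mult_left: "alg_ideal I \<Longrightarrow> a \<in> I \<Longrightarrow> b * a \<in> I"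
  and alg_ideal_subspace: "alg_ideal I \<Longrightarrow> subspace I"
  by (auto simp: alg_ideal_def)

lemma alg_ideal_zero: "alg_ideal {0}"
  by (auto simp: alg_ideal_def)

text \<open>The free middle factor \<open>z\<close> absorbs a factor to the right of
  \<open>u\<close>, while \<open>I\<close> absorbs one to its left; hence the quotient is two-sided
  for an arbitrary set \<open>V\<close>.\<close>

lemma alg_ideal_left_quotient:
  assumes "alg_ideal I"
  shows "alg_ideal {u. \<forall>z. \<forall>v\<in>V. u * z * v \<in> I}"
proof -
  note sub = alg_ideal_subspace[OF assms]
  have "u * b * z * v \<in> I" "b * u * z * v \<in> I" if "\<forall>z. \<forall>v\<in>V. u * z * v \<in> I" "v \<in> V" for u b z v
    using that alg_ideal_mult_left[OF assms, of "u * z * v" b]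
      that(1)[THEN spec, of "b * z"] by (simp_all add: mult.assoc)
  then show ?thesis
    unfolding alg_ideal_def subspace_def
    by (auto simp: distrib_right scale_mult_left subspace_add[OF sub] subspace_scale[OF sub] subspace_0[OF sub])
qed

lemma alg_ideal_right_quotient:
  assumes "alg_ideal I"
  shows "alg_ideal {v. \<forall>u\<in>U. \<forall>z. u * z * v \<in> I}"
proof -
  note sub = alg_ideal_subspace[OF assms]
  have "u * z * (v * b) \<in> I" "u * z * (b * v) \<in> I" if "\<forall>u\<in>U. \<forall>z. u * z * v \<in> I" "u \<in> U" for u b z v
    using that alg_ideal_mult_right[OF assms, of "u * z * v" b]
      bspec[OF that(1) that(2), THEN spec, of "z * b"] by (simp_all add: mult.assoc)
  then show ?thesis
    unfolding alg_ideal_def subspace_def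
    by (auto simp: distrib_left scale_mult_right subspace_add[OF sub] subspace_scale[OF sub] subspace_0[OF sub])
qed

text \<open>Linearization: over an infinite field all coefficients of the expansion of (x +
  \<alpha>y)^(m+1) lie in \<open>I\<close>, in particular the linear one.\<close>

lemma power_deriv_in_ideal:
  assumes "infinite (UNIV :: 'f set)" "alg_ideal I"
    and "\<And>x. nonempty_prod (replicate (Suc m) x) \<in> I"
  shows "power_deriv x y m \<in> I"
proof -
  obtain c where c: "\<And>\<alpha>. nonempty_prod (replicate (Suc m) (x + scale \<alpha> y)) = (\<Sum>k\<le>Suc m. scale (\<alpha> ^ k) (c k))"
     "c 1 = power_deriv x y m"
    using power_expansion by blast
  have "(\<Sum>k\<le>Suc m. scale (\<alpha> ^ k) (c k)) \<in> I" for \<alpha>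
    using assms(3)[of "x + scale \<alpha> y"] unfolding c(1) .
  then have "c 1 \<in> I"
    using coeffs_in_subspace[OF alg_ideal_subspace[OF assms(2)] assms(1),
        where n = "Suc m" and c = c and k = 1] by simp
  with c(2) show ?thesis by simp
qed

text \<open>
  Higman's double sum of the words \<open>x\<^sup>i z y\<^sup>j x\<^sup>M\<^sup>-\<^sup>i y\<^sup>M\<^sup>-\<^sup>j\<close> with \<open>i, j \<le> M\<close>: for each \<open>j\<close> the sum
  over \<open>i\<close> vanishes modulo \<open>I\<close>, while for each \<open>i < M\<close> the sum over \<open>j\<close> does; the summand \<open>i = M\<close>
  leaves \<open>(M + 1) x\<^sup>M z y\<^sup>M\<close>.
\<close>

lemma power_mult_power_in_ideal:
  assumes char: "CHAR('f) = 0" and I: "alg_ideal I"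
    and pow: "\<And>x. nonempty_prod (replicate (Suc M) x) \<in> I" and "M > 0"
  shows "nonempty_prod (replicate M x) * z * nonempty_prod (replicate M y) \<in> I"
proof -
  have inf: "infinite (UNIV :: 'f set)"
    by (rule infinite_super[OF subset_UNIV range_inj_infinite[OF inj_of_nat_CHAR_0[OF char]]])
  note deriv = power_deriv_in_ideal[OF inf I pow]
  note sub = alg_ideal_subspace[OF I]
  define t where "t i j = nonempty_prod (replicate i x @ (z # replicate j y) @ replicate (M - i) x @ replicate (M - j) y)" for i j
  let ?P = "nonempty_prod (replicate M x) * z * nonempty_prod (replicate M y)"
  have "(\<Sum>i\<le>M. t i j) \<in> I" for j
  proof -
    \<comment> \<open>With z y^j read as one letter \<open>w\<close>, the sum over \<open>i\<close>
      is a linear part of a power of \<open>x\<close>, followed by y^(M-j).\<close>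
    define w where "w = nonempty_prod (z # replicate j y)"
    have t: "t i j = nonempty_prod ((replicate i x @ w # replicate (M - i) x) @ replicate (M - j) y)" for i
      unfolding t_def w_def append_assoc append_Cons[symmetric]
      using nonempty_prod_nested[of "z # replicate j y" "replicate i x" "replicate (M - i) x @ replicate (M - j) y"]
      by simp
    show ?thesis
    \<comment> \<open>For \<open>j = M\<close> no trailing factor remains, and the empty product
      could not stand in for it.\<close>
    proof (cases "M - j = 0")
      case True
      then have "(\<Sum>i\<le>M. t i j) = power_deriv x w M" by (simp add: t power_deriv_def)
      then show ?thesis using deriv by simp
    next
      case False
      then have "(\<Sum>i\<le>M. t i j) = power_deriv x w M * nonempty_prod (replicate (M - j) y)"
        by (simp add: t nonempty_prod_append power_deriv_def sum_distrib_right del: append_assoc append_Cons)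
      then show ?thesis using deriv alg_ideal_mult_right[OF I] by simp
    qed
  qed
  then have "(\<Sum>j\<le>M. \<Sum>i\<le>M. t i j) \<in> I" by (rule subspace_sum[OF sub])
  then have all: "(\<Sum>i\<le>M. \<Sum>j\<le>M. t i j) \<in> I" by (subst sum.swap)
  have "(\<Sum>j\<le>M. t i j) \<in> I" if "i < M" for i
  proof -
    \<comment> \<open>Now the letter is x^(M-i), a genuine product because
      \<open>i < M\<close>.\<close>
    define w where "w = nonempty_prod (replicate (M - i) x)"
    have "t i j = nonempty_prod (replicate i x @ [z]) * nonempty_prod (replicate j y @ w # replicate (M - j) y)" for j
      using that unfolding t_def w_def
      by (simp add: nonempty_prod_nested flip: nonempty_prod_append)
    then have "(\<Sum>j\<le>M. t i j) = nonempty_prod (replicate i x @ [z]) * power_deriv y w M"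
      by (simp add: power_deriv_def sum_distrib_left)
    then show ?thesis using deriv alg_ideal_mult_left[OF I] by simp
  qed
  then have rest: "(\<Sum>i<M. \<Sum>j\<le>M. t i j) \<in> I" by (rule subspace_sum[OF sub]) simp
  \<comment> \<open>For \<open>i = M\<close> nothing separates the two powers of \<open>y\<close>,
    so they merge into y^M whatever \<open>j\<close> is.\<close>
  have "t M j = ?P" if "j \<le> M" for j
  proof -
    have "t M j = nonempty_prod (replicate M x @ [z] @ replicate M y)"
      using that by (simp add: t_def flip: replicate_add)
    then show ?thesis using \<open>M > 0\<close> by (simp add: nonempty_prod_append nonempty_prod_Cons mult.assoc)
  qed
  \<comment> \<open>Inserting \<open>scale 1\<close> turns the M + 1 equal summands into a scalar
    multiple, whose scalar is invertible in characteristic zero.\<close>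
  then have "(\<Sum>j\<le>M. t M j) = (\<Sum>j\<le>M. scale 1 ?P)" by simp
  also have "\<dots> = scale (of_nat (Suc M)) ?P" by (subst scale_sum_left[symmetric]) simp
  finally have "scale (of_nat (Suc M)) ?P = (\<Sum>i\<le>M. \<Sum>j\<le>M. t i j) - (\<Sum>i<M. \<Sum>j\<le>M. t i j)"
    by (simp add: lessThan_Suc_atMost[symmetric])
  then have "scale (of_nat (Suc M)) ?P \<in> I" using subspace_diff[OF sub all rest] by simp
  then have "scale (inverse (of_nat (Suc M))) (scale (of_nat (Suc M)) ?P) \<in> I"
    by (rule subspace_scale[OF sub])
  moreover have "(of_nat (Suc M) :: 'f) \<noteq> 0"
    using char by (simp only: of_nat_eq_0_iff_char_dvd) simp
  ultimately show ?thesis by simp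
qed

text \<open>
  Nagata--Higman for the algebra modulo \<open>I\<close>. Working modulo ideals lets the induction on the nil
  index run without quotient types, and ideal quotients in the role of the ideal generated by
  the powers \<open>x\<^sup>M\<close> make generators unnecessary.
\<close>

lemma nagata_higman:
  assumes char: "CHAR('f) = 0" and "alg_ideal I"
    and "\<And>x. nonempty_prod (replicate (Suc m) x) \<in> I"
  shows "\<exists>N>0. \<forall>as. length as = N \<longrightarrow> nonempty_prod as \<in> I"
  using assms(2,3)
proof (induction m arbitrary: I)
  case 0
  have "nonempty_prod as \<in> I" if "length as = 1" for as
    using that 0(2) by (auto simp: length_Suc_conv)
  then show ?case by (intro exI[of _ 1]) simp
next
  case (Suc m)
  let ?p = "\<lambda>x. nonempty_prod (replicate (Suc m) x)"
  \<comment> \<open>Both ideals contain every x^(m+1): \<open>K\<close> by Higman's double sum,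
    \<open>L\<close> because \<open>K\<close> kills these powers modulo \<open>I\<close>. So the
    induction hypothesis applies to \<open>K\<close> and \<open>L\<close>.\<close>
  define K where "K = {u. \<forall>z. \<forall>v\<in>range ?p. u * z * v \<in> I}"
  define L where "L = {v. \<forall>u\<in>K. \<forall>z. u * z * v \<in> I}"
  have "?p x \<in> K" for x
    using power_mult_power_in_ideal[OF char Suc.prems] by (auto simp: K_def)
  moreover have "alg_ideal K" unfolding K_def by (rule alg_ideal_left_quotient[OF Suc.prems(1)])
  ultimately obtain N where N: "N > 0" "\<And>as. length as = N \<Longrightarrow> nonempty_prod as \<in> K"
    using Suc.IH by blast
  have "?p x \<in> L" for x by (auto simp: K_def L_def)
  moreover have "alg_ideal L" unfolding L_def by (rule alg_ideal_right_quotient[OF Suc.prems(1)])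
  ultimately obtain N' where N': "N' > 0" "\<And>as. length as = N' \<Longrightarrow> nonempty_prod as \<in> L"
    using Suc.IH by blast
  \<comment> \<open>The extra letter supplies the middle factor between a word in \<open>K\<close>
    and a word in \<open>L\<close>.\<close>
  have "nonempty_prod as \<in> I" if len: "length as = N + Suc N'" for as
  proof -
    obtain us z vs where as: "as = us @ z # vs" "length us = N" "length vs = N'"
    proof
      have "drop N as = as ! N # drop (Suc N) as" using len by (simp add: Cons_nth_drop_Suc)
      then show "as = take N as @ as ! N # drop (Suc N) as" by (metis append_take_drop_id)
    qed (use len in auto)
    with N N' have "nonempty_prod us * z * nonempty_prod vs \<in> I" unfolding L_def by blast
    moreover have "us \<noteq> []" "vs \<noteq> []" using as N(1) N'(1) by auto
    ultimately show ?thesis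
      by (simp add: as(1) nonempty_prod_append nonempty_prod_Cons mult.assoc)
  qed
  then show ?case by (intro exI[of _ "N + Suc N'"]) simp
qed

end

section \<open>The Baire category argument\<close>

lemma continuous_on_power_replicate:
  fixes f :: "'b::topological_space \<Rightarrow> 'c::{ring, topological_space}"
  assumes mult: "continuous_on UNIV (\<lambda>(x :: 'c, y). x * y)" and f: "continuous_on S f"
  shows "continuous_on S (\<lambda>x. nonempty_prod (replicate (Suc n) (f x)))"
proof (induction n)
  case 0
  then show ?case using f by simp
next
  case (Suc n)
  then have "continuous_on S (\<lambda>x. case (f x, nonempty_prod (replicate (Suc n) (f x))) of (x, y) \<Rightarrow> x * y)"
    by (intro continuous_on_compose2[OF mult] continuous_on_Pair f) auto
  then show ?case by simp
qed

lemma nil_algebra_open_bounded_index: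
  assumes mult: "continuous_on UNIV (\<lambda>(x :: 'c::{ring, complete_space}, y). x * y)"
    and nil: "nil_algebra TYPE('c)"
  obtains U and n :: nat where "open U" "U \<noteq> {}" "\<And>x::'c. x \<in> U \<Longrightarrow> nonempty_prod (replicate (Suc n) x) = 0"
proof -
  define Z where "Z n = {x::'c. nonempty_prod (replicate (Suc n) x) = 0}" for n
  have closed: "closed (Z n)" for n
    unfolding Z_def
    by (intro closed_Collect_eq continuous_on_power_replicate[OF mult] continuous_intros)
  have "x \<in> (\<Union>n. Z n)" for x
  proof -
    obtain n where "n > 0" "nonempty_prod (replicate n x) = 0" using nil by (auto simp: nil_algebra_def)
    then have "x \<in> Z (n - 1)" by (simp only: Z_def mem_Collect_eq Suc_diff_1)
    then show ?thesis by blast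
  qed
  then have "\<Union>(range Z) = UNIV" by auto
  then have "interior (\<Union>(range Z)) \<noteq> {}" by simp
  moreover have "interior (\<Union>(range Z)) = {}" if "\<And>n. interior (Z n) = {}"
    using Met_TC.metric_Baire_category_alt[of "range Z"] closed that
    by (auto simp: complete_UNIV)
  ultimately obtain n where "interior (Z n) \<noteq> {}" by blast
  then show ?thesis
    using that[of "interior (Z n)" n] interior_subset[of "Z n"] by (auto simp: Z_def)
qed

section \<open>Perturbation by small scalars\<close>

text \<open>Homogeneity under \<open>of_nat k\<close>, applied to 1/k. The factor
  \<open>nrm 1\<close> stays, as submultiplicativity does not force it to be 1.\<close>

lemma (in normed_field) nrm_inverse_of_nat:
  assumes "CHAR('f) = 0" "k > 0"
  shows "nrm (inverse (of_nat k)) = nrm 1 / real k"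
proof -
  have "(of_nat k :: 'f) \<noteq> 0" using assms by (simp add: of_nat_eq_0_iff_char_dvd)
  then show ?thesis
    using nrm_of_nat_mult[OF assms(1), of k "inverse (of_nat k)"] assms(2) by (simp add: field_simps)
qed

text \<open>Translation by \<open>c\<close> and scaling cost one factor \<gamma> each, so the
  distance is at most a constant over k + 1.\<close>

lemma (in metric_algebra) tendsto_add_small_scale:
  assumes "CHAR('f) = 0"
  shows "(\<lambda>k. c + scale (inverse (of_nat (Suc k))) a) \<longlonglongrightarrow> c"
proof -
  obtain \<gamma> where \<gamma>: "\<gamma> > 0"
    "\<And>a b c. dist (a + c) (b + c :: 'a) \<le> \<gamma> * dist a b"
    "\<And>\<alpha> a b. dist (scale \<alpha> a) (scale \<alpha> b) \<le> \<gamma> * nrm \<alpha> * dist a b"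
    using ex_gamma by blast
  have "dist (c + scale (inverse (of_nat (Suc k))) a) c \<le> \<gamma> * (\<gamma> * nrm 1 * dist a 0) * (1 / real (Suc k))" for k
  proof -
    let ?\<alpha> = "inverse (of_nat (Suc k)) :: 'f"
    have "dist (c + scale ?\<alpha> a) c \<le> \<gamma> * dist (scale ?\<alpha> a) 0"
      using \<gamma>(2)[of "scale ?\<alpha> a" c 0] by (simp add: add.commute)
    also have "\<dots> \<le> \<gamma> * (\<gamma> * nrm ?\<alpha> * dist a 0)"
      using \<gamma>(3)[of ?\<alpha> a 0] \<gamma>(1) by (intro mult_left_mono) auto
    finally show ?thesis
      by (subst (asm) nrm_inverse_of_nat[OF assms]) (simp_all add: field_simps del: of_nat_Suc)
  qed
  moreover have "(\<lambda>k. \<gamma> * (\<gamma> * nrm 1 * dist a 0) * (1 / real (Suc k))) \<longlonglongrightarrow> 0"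
    using tendsto_mult_right_zero[OF LIMSEQ_inverse_real_of_nat] by (simp add: field_simps)
  ultimately show ?thesis
    by (subst tendsto_dist_iff) (rule tendsto_sandwich[OF _ _ tendsto_const, rotated 2], auto)
qed

lemma (in metric_algebra) bounded_index_of_open:
  assumes char: "CHAR('f) = 0" and U: "open U" "U \<noteq> {}"
    and nil: "\<And>x :: 'a. x \<in> U \<Longrightarrow> nonempty_prod (replicate (Suc n) x) = 0"
  shows "nonempty_prod (replicate (Suc n) a) = (0 :: 'a)"
proof -
  obtain c where "c \<in> U" using U(2) by blast
  have "eventually (\<lambda>k. c + scale (inverse (of_nat (Suc k))) a \<in> U) sequentially"
    using topological_tendstoD[OF tendsto_add_small_scale[OF char] U(1) \<open>c \<in> U\<close>] .
  then obtain k0 where k0: "\<And>k. k \<ge> k0 \<Longrightarrow> c + scale (inverse (of_nat (Suc k))) a \<in> U"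
    by (auto simp: eventually_sequentially)
  \<comment> \<open>These scalars are pairwise distinct because \<open>of_nat\<close> is injective
    in characteristic zero.\<close>
  define S where "S = (\<lambda>k. inverse (of_nat (Suc k)) :: 'f) ` {k0..}"
  have "inj_on (\<lambda>k. inverse (of_nat (Suc k)) :: 'f) {k0..}"
    using inj_of_nat_CHAR_0[OF char] by (auto simp: inj_on_def simp del: of_nat_Suc)
  then have "infinite S" unfolding S_def by (simp add: finite_image_iff infinite_Ici)
  obtain p where p: "\<And>\<alpha>. nonempty_prod (replicate (Suc n) (c + scale \<alpha> a)) = (\<Sum>k\<le>Suc n. scale (\<alpha> ^ k) (p k))"
     "p (Suc n) = nonempty_prod (replicate (Suc n) a)"
    using power_expansion by blast
  have "p (Suc n) \<in> {0}"
  proof (rule lead_coeff_in_subspace[OF _ \<open>infinite S\<close>])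
    show "subspace {0}" by simp
    fix \<alpha> assume "\<alpha> \<in> S"
    then have "c + scale \<alpha> a \<in> U" using k0 by (auto simp: S_def)
    then show "(\<Sum>k\<le>Suc n. scale (\<alpha> ^ k) (p k)) \<in> {0}" using nil p(1) by (metis singleton_iff)
  qed
  with p(2) show ?thesis by simp
qed

section \<open>Return from the completion to the algebra\<close>

lemma (in algebra_completion) iota_nonempty_prod:
  "\<iota> (nonempty_prod as) = nonempty_prod (map \<iota> as)"
  by (induction as rule: nonempty_prod.induct) (simp_all add: iota_0 extends_mult)

theorem corollary2p4:
  fixes nrm :: "'f::field \<Rightarrow> real"
    and scale :: "'f \<Rightarrow> 'a::{ring, metric_space} \<Rightarrow> 'a"
    and scaleC :: "'f \<Rightarrow> 'c::{ring, complete_space} \<Rightarrow> 'c"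
    and \<iota> :: "'a \<Rightarrow> 'c"
  assumes "normed_field nrm"
    and "CHAR('f) = 0"
    and "metric_algebra nrm scale"
    and "algebra_completion scale scaleC \<iota>"
    and "nil_algebra TYPE('c)"
  shows "nilpotent_algebra TYPE('a)"
proof -
  interpret \<iota>: algebra_completion scale scaleC \<iota> by fact
  interpret C: metric_algebra nrm scaleC by (rule \<iota>.metric_algebra_completion) fact
  obtain U and n :: nat where "open U" "U \<noteq> {}"
    "\<And>x::'c. x \<in> U \<Longrightarrow> nonempty_prod (replicate (Suc n) x) = 0"
    using nil_algebra_open_bounded_index[OF \<iota>.continuous_mult assms(5)] by blast
  then have "nonempty_prod (replicate (Suc n) x) = 0" for x :: 'c
    using C.bounded_index_of_open[OF assms(2)] by blast
  then obtain N where N: "N > 0" "\<And>as::'c list. length as = N \<Longrightarrow> nonempty_prod as = 0"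
    using C.nagata_higman[OF assms(2) C.alg_ideal_zero] by (metis singleton_iff)
  \<comment> \<open>The same \<open>N\<close> serves, since \<open>\<iota>\<close> is multiplicative
    and, being isometric, injective.\<close>
  have "nonempty_prod as = 0" if "length as = N" for as :: "'a list"
  proof -
    have "\<iota> (nonempty_prod as) = \<iota> 0"
      using N(2)[of "map \<iota> as"] that by (simp add: \<iota>.iota_nonempty_prod \<iota>.iota_0)
    then show ?thesis using \<iota>.isometric[of "nonempty_prod as" 0] by simp
  qed
  with N(1) show ?thesis unfolding nilpotent_algebra_def by blast
qed

end
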